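(* Let $\gamma>1$. Consider the time-optimal control problem: find a Lebesgue measurable control $u$ with $-1\le u(t)\le 1$ such that, starting from $(x_1(0),x_2(0))=(1,0)$, the system $$\dot x_1=x_2,\qquad \dot x_2=-u x_1+\frac{1}{x_1^2}$$ reaches the final point $(x_1(T),x_2(T))=(\gamma,0)$ in minimum time $T$, under the state constraint $x_2(t)\ge 0$. Then the minimum time is $T=T_1+T_2$, where $$T_1=\int_1^{\beta}\sqrt{\frac{x}{(x-1)(x^2+x+2)}}\,dx,\qquad T_2=\int_{\beta}^{\gamma}\sqrt{\frac{x}{(\gamma-x)\left(x^2+\gamma x-2/\gamma\right)}}\,dx,$$ and $$\beta=\sqrt{\frac{\gamma^3-\gamma+2}{2\gamma}}.$$
   Context: The state $(x_1,x_2)$ lies in $D=\{(x_1,x_2)\in\mathbb{R}^2: x_1>0,\ x_2\ge 0\}$. Admissible controls are Lebesgue measurable functions with values in $[-1,1]$ (almost everywhere); the corresponding trajectories are the absolutely continuous solutions of the system. *)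

theory Defs
  imports "HOL-Analysis.Analysis"
begin

text \<open>
  Absolute continuity of a real function on the interval from \<open>a\<close> to \<open>b\<close>
  (the library only has absolute continuity of measures).  A pair \<open>(s, t)\<close> in
  \<open>P\<close> stands for the open interval from \<open>s\<close> to \<open>t\<close>.
\<close>

definition abs_continuous_on_interval :: "real \<Rightarrow> real \<Rightarrow> (real \<Rightarrow> real) \<Rightarrow> bool" where
  "abs_continuous_on_interval a b f \<longleftrightarrow>
     (\<forall>\<epsilon>>0. \<exists>\<delta>>0. \<forall>P :: (real \<times> real) set.
        finite P \<longrightarrow>
        (\<forall>(s, t)\<in>P. a \<le> s \<and> s < t \<and> t \<le> b) \<longrightarrow>
        disjoint_family_on (\<lambda>(s, t). {s<..<t}) P \<longrightarrow>
        (\<Sum>(s, t)\<in>P. t - s) < \<delta> \<longrightarrow>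
        (\<Sum>(s, t)\<in>P. \<bar>f t - f s\<bar>) < \<epsilon>)"

definition state_domain :: "(real \<times> real) set" where
  "state_domain = {(x\<^sub>1, x\<^sub>2). x\<^sub>1 > 0 \<and> x\<^sub>2 \<ge> 0}"

definition admissible_control :: "real \<Rightarrow> (real \<Rightarrow> real) \<Rightarrow> bool" where
  "admissible_control T u \<longleftrightarrow>
     u \<in> borel_measurable (lebesgue_on {0..T}) \<and>
     (AE t in lebesgue_on {0..T}. -1 \<le> u t \<and> u t \<le> 1)"

definition trajectory ::
  "real \<Rightarrow> (real \<Rightarrow> real) \<Rightarrow> (real \<Rightarrow> real) \<Rightarrow> (real \<Rightarrow> real) \<Rightarrow> bool" where
  "trajectory T u x\<^sub>1 x\<^sub>2 \<longleftrightarrow>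
     abs_continuous_on_interval 0 T x\<^sub>1 \<and>
     abs_continuous_on_interval 0 T x\<^sub>2 \<and>
     (\<forall>t\<in>{0..T}. (x\<^sub>1 t, x\<^sub>2 t) \<in> state_domain) \<and>
     (AE t in lebesgue_on {0..T}.
        (x\<^sub>1 has_real_derivative x\<^sub>2 t) (at t within {0..T}) \<and>
        (x\<^sub>2 has_real_derivative (- u t * x\<^sub>1 t + 1 / (x\<^sub>1 t)\<^sup>2)) (at t within {0..T}))"

definition transfer_times :: "real \<times> real \<Rightarrow> real \<times> real \<Rightarrow> real set" where
  "transfer_times p q =
     {T. 0 \<le> T \<and>
         (\<exists>u x\<^sub>1 x\<^sub>2. admissible_control T u \<and> trajectory T u x\<^sub>1 x\<^sub>2 \<and>
                    (x\<^sub>1 0, x\<^sub>2 0) = p \<and> (x\<^sub>1 T, x\<^sub>2 T) = q)}"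

definition is_minimum_time :: "real \<times> real \<Rightarrow> real \<times> real \<Rightarrow> real \<Rightarrow> bool" where
  "is_minimum_time p q T \<longleftrightarrow>
     T \<in> transfer_times p q \<and> (\<forall>S\<in>transfer_times p q. T \<le> S)"

end

theory Submission
  imports Defs
begin

text \<open>
  Write \<open>x\<close>, \<open>y\<close> for position and velocity.  Along any admissible trajectory
  \<open>y\<^sup>2 - x\<^sup>2 + 2 / x\<close> has derivative \<open>- 2 x y (1 + u) \<le> 0\<close> and \<open>y\<^sup>2 + x\<^sup>2 + 2 / x\<close> has
  derivative \<open>2 x y (1 - u) \<ge> 0\<close>; the signs come from \<open>x > 0\<close>, \<open>y \<ge> 0\<close> and \<open>\<bar>u\<bar> \<le> 1\<close>.
  Comparing the first quantity with its value at the start \<open>(1, 0)\<close> and the second with its value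
  at the end \<open>(\<gamma>, 0)\<close> gives
  \<open>y\<^sup>2 \<le> min (x\<^sup>2 - 2 / x + 1) (\<gamma>\<^sup>2 + 2 / \<gamma> - x\<^sup>2 - 2 / x)\<close>, that is \<open>y \<le> v x\<close> with \<open>v\<close> the
  \<open>top_speed\<close> below.  So the problem is one-dimensional: travel from \<open>1\<close> to \<open>\<gamma>\<close> under the
  position-dependent speed limit \<open>v\<close>, which takes at least the integral of \<open>1 / v\<close>
  (\<open>travel_time_lower_bound\<close>).  For \<open>x > 0\<close> the two terms of the minimum agree exactly at \<open>\<beta>\<close>, the first being
  the smaller one to the left of \<open>\<beta>\<close> and the second to its right, which splits the integral into
  \<open>T\<^sub>1 + T\<^sub>2\<close>.

  The bound is attained by always moving at the limit: the position is the inverse function of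
  \<open>x \<mapsto> integral {1..x} (1 / v)\<close> (\<open>travel_at_prescribed_speed\<close>).  Its velocity \<open>v (x t)\<close> satisfies
  the second state equation with \<open>u = -1\<close> up to \<open>\<beta>\<close> and \<open>u = 1\<close> beyond, so this is the bang-bang
  trajectory.

  Trajectories are only absolutely continuous, so the monotonicity of the two quantities
  (\<open>trajectory_monotone_quantities\<close>) needs the fact that an absolutely continuous function whose
  derivative has a sign almost everywhere is monotone (\<open>AC_nonincreasing\<close>).
\<close>

section \<open>Absolutely continuous functions\<close>

lemma AC_D:
  assumes "abs_continuous_on_interval a b f" "e > 0"
  obtains d where "d > 0"
    "\<And>P. finite P \<Longrightarrow> (\<And>s t. (s, t) \<in> P \<Longrightarrow> a \<le> s \<and> s < t \<and> t \<le> b) \<Longrightarrow>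
       disjoint_family_on (\<lambda>(s, t). {s<..<t}) P \<Longrightarrow> (\<Sum>(s, t)\<in>P. t - s) < d \<Longrightarrow>
       (\<Sum>(s, t)\<in>P. \<bar>f t - f s\<bar>) < e"
proof -
  obtain d where d: "d > 0" "\<forall>P. finite P \<longrightarrow> (\<forall>(s, t)\<in>P. a \<le> s \<and> s < t \<and> t \<le> b) \<longrightarrow>
        disjoint_family_on (\<lambda>(s, t). {s<..<t}) P \<longrightarrow> (\<Sum>(s, t)\<in>P. t - s) < d \<longrightarrow>
        (\<Sum>(s, t)\<in>P. \<bar>f t - f s\<bar>) < e"
    using assms unfolding abs_continuous_on_interval_def by meson
  show ?thesis
    by (rule that[OF d(1)]) (use d(2) in auto)
qed

lemma AC_I:
  assumes "\<And>e. e > 0 \<Longrightarrow> \<exists>d>0. \<forall>P. finite P \<longrightarrow> (\<forall>s t. (s, t) \<in> P \<longrightarrow> a \<le> s \<and> s < t \<and> t \<le> b) \<longrightarrow>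
        disjoint_family_on (\<lambda>(s, t). {s<..<t}) P \<longrightarrow> (\<Sum>(s, t)\<in>P. t - s) < d \<longrightarrow>
        (\<Sum>(s, t)\<in>P. \<bar>f t - f s\<bar>) < e"
  shows "abs_continuous_on_interval a b f"
  unfolding abs_continuous_on_interval_def
proof (intro allI impI)
  fix e :: real assume "e > 0"
  from assms[OF this] show "\<exists>\<delta>>0. \<forall>P. finite P \<longrightarrow> (\<forall>(s, t)\<in>P. a \<le> s \<and> s < t \<and> t \<le> b) \<longrightarrow>
      disjoint_family_on (\<lambda>(s, t). {s<..<t}) P \<longrightarrow> (\<Sum>(s, t)\<in>P. t - s) < \<delta> \<longrightarrow>
      (\<Sum>(s, t)\<in>P. \<bar>f t - f s\<bar>) < e"
    by (elim ex_forward conj_forward all_forward) auto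
qed

text \<open>
  Both composition with Lipschitz functions and absolute continuity of Lipschitz functions (with the
  identity as \<open>f\<close>) are instances.
\<close>

lemma AC_dominated:
  assumes f: "abs_continuous_on_interval a b f"
    and g: "\<And>s t. a \<le> s \<Longrightarrow> s < t \<Longrightarrow> t \<le> b \<Longrightarrow> \<bar>g t - g s\<bar> \<le> L * \<bar>f t - f s\<bar>"
  shows "abs_continuous_on_interval a b g"
proof (rule AC_I)
  fix e :: real assume e: "e > 0"
  define M where "M = max L 1"
  have M: "M > 0" "L \<le> M" by (auto simp: M_def)
  obtain d where d: "d > 0" "\<And>P. finite P \<Longrightarrow> (\<And>s t. (s, t) \<in> P \<Longrightarrow> a \<le> s \<and> s < t \<and> t \<le> b) \<Longrightarrow>
       disjoint_family_on (\<lambda>(s, t). {s<..<t}) P \<Longrightarrow> (\<Sum>(s, t)\<in>P. t - s) < d \<Longrightarrow>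
       (\<Sum>(s, t)\<in>P. \<bar>f t - f s\<bar>) < e / M"
    using AC_D[OF f, of "e / M"] e M by auto
  show "\<exists>d>0. \<forall>P. finite P \<longrightarrow> (\<forall>s t. (s, t) \<in> P \<longrightarrow> a \<le> s \<and> s < t \<and> t \<le> b) \<longrightarrow>
        disjoint_family_on (\<lambda>(s, t). {s<..<t}) P \<longrightarrow> (\<Sum>(s, t)\<in>P. t - s) < d \<longrightarrow>
        (\<Sum>(s, t)\<in>P. \<bar>g t - g s\<bar>) < e"
  proof (intro exI[of _ d] conjI allI impI d(1))
    fix P :: "(real \<times> real) set"
    assume P: "finite P" "\<forall>s t. (s, t) \<in> P \<longrightarrow> a \<le> s \<and> s < t \<and> t \<le> b"
      "disjoint_family_on (\<lambda>(s, t). {s<..<t}) P" "(\<Sum>(s, t)\<in>P. t - s) < d"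
    have "(\<Sum>(s, t)\<in>P. \<bar>g t - g s\<bar>) \<le> (\<Sum>(s, t)\<in>P. M * \<bar>f t - f s\<bar>)"
    proof (rule sum_mono, clarify)
      fix s t assume "(s, t) \<in> P"
      with P(2) have "\<bar>g t - g s\<bar> \<le> L * \<bar>f t - f s\<bar>" using g by blast
      also have "\<dots> \<le> M * \<bar>f t - f s\<bar>" using M by (intro mult_right_mono) auto
      finally show "\<bar>g t - g s\<bar> \<le> M * \<bar>f t - f s\<bar>" .
    qed
    also have "\<dots> = M * (\<Sum>(s, t)\<in>P. \<bar>f t - f s\<bar>)"
      by (simp add: sum_distrib_left case_prod_unfold)
    also have "\<dots> < M * (e / M)"
      using d(2)[of P] P M by (intro mult_strict_left_mono) auto
    finally show "(\<Sum>(s, t)\<in>P. \<bar>g t - g s\<bar>) < e" using M by simp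
  qed
qed

lemma AC_id: "abs_continuous_on_interval a b (\<lambda>t. t)"
proof (rule AC_I)
  fix e :: real assume e: "e > 0"
  have *: "(\<Sum>(s, t)\<in>P. \<bar>t - s\<bar>) = (\<Sum>(s, t)\<in>P. t - s)"
    if "\<forall>s t. (s, t) \<in> P \<longrightarrow> a \<le> s \<and> s < t \<and> t \<le> b" for P :: "(real \<times> real) set"
    using that by (intro sum.cong) (auto simp: abs_if dest!: spec)
  show "\<exists>d>0. \<forall>P. finite P \<longrightarrow> (\<forall>s t. (s, t) \<in> P \<longrightarrow> a \<le> s \<and> s < t \<and> t \<le> b) \<longrightarrow>
        disjoint_family_on (\<lambda>(s, t). {s<..<t}) P \<longrightarrow> (\<Sum>(s, t)\<in>P. t - s) < d \<longrightarrow>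
        (\<Sum>(s, t)\<in>P. \<bar>t - s\<bar>) < e"
    using e * by (intro exI[of _ e]) auto
qed

lemma AC_add:
  assumes "abs_continuous_on_interval a b f" "abs_continuous_on_interval a b g"
  shows "abs_continuous_on_interval a b (\<lambda>t. f t + g t)"
proof (rule AC_I)
  fix e :: real assume e: "e > 0"
  obtain d where d: "d > 0" "\<And>P. finite P \<Longrightarrow> (\<And>s t. (s, t) \<in> P \<Longrightarrow> a \<le> s \<and> s < t \<and> t \<le> b) \<Longrightarrow>
       disjoint_family_on (\<lambda>(s, t). {s<..<t}) P \<Longrightarrow> (\<Sum>(s, t)\<in>P. t - s) < d \<Longrightarrow>
       (\<Sum>(s, t)\<in>P. \<bar>f t - f s\<bar>) < e / 2"
    using AC_D[OF assms(1), of "e / 2"] e by auto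
  obtain d' where d': "d' > 0" "\<And>P. finite P \<Longrightarrow> (\<And>s t. (s, t) \<in> P \<Longrightarrow> a \<le> s \<and> s < t \<and> t \<le> b) \<Longrightarrow>
       disjoint_family_on (\<lambda>(s, t). {s<..<t}) P \<Longrightarrow> (\<Sum>(s, t)\<in>P. t - s) < d' \<Longrightarrow>
       (\<Sum>(s, t)\<in>P. \<bar>g t - g s\<bar>) < e / 2"
    using AC_D[OF assms(2), of "e / 2"] e by auto
  show "\<exists>d>0. \<forall>P. finite P \<longrightarrow> (\<forall>s t. (s, t) \<in> P \<longrightarrow> a \<le> s \<and> s < t \<and> t \<le> b) \<longrightarrow>
        disjoint_family_on (\<lambda>(s, t). {s<..<t}) P \<longrightarrow> (\<Sum>(s, t)\<in>P. t - s) < d \<longrightarrow>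
        (\<Sum>(s, t)\<in>P. \<bar>(f t + g t) - (f s + g s)\<bar>) < e"
  proof (intro exI[of _ "min d d'"] conjI allI impI)
    fix P :: "(real \<times> real) set"
    assume P: "finite P" "\<forall>s t. (s, t) \<in> P \<longrightarrow> a \<le> s \<and> s < t \<and> t \<le> b"
      "disjoint_family_on (\<lambda>(s, t). {s<..<t}) P" "(\<Sum>(s, t)\<in>P. t - s) < min d d'"
    have "(\<Sum>(s, t)\<in>P. \<bar>(f t + g t) - (f s + g s)\<bar>)
        \<le> (\<Sum>(s, t)\<in>P. \<bar>f t - f s\<bar> + \<bar>g t - g s\<bar>)"
      by (intro sum_mono) auto
    also have "\<dots> = (\<Sum>(s, t)\<in>P. \<bar>f t - f s\<bar>) + (\<Sum>(s, t)\<in>P. \<bar>g t - g s\<bar>)"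
      by (simp add: sum.distrib case_prod_unfold)
    also have "\<dots> < e / 2 + e / 2"
      by (intro add_strict_mono d(2) d'(2)) (use P in auto)
    finally show "(\<Sum>(s, t)\<in>P. \<bar>(f t + g t) - (f s + g s)\<bar>) < e" by simp
  qed (use d d' in auto)
qed

lemma AC_minus:
  assumes "abs_continuous_on_interval a b f"
  shows "abs_continuous_on_interval a b (\<lambda>t. - f t)"
  by (rule AC_dominated[OF assms, where L = 1]) auto

lemma AC_subinterval:
  assumes "abs_continuous_on_interval a b f" "a \<le> c" "d \<le> b"
  shows "abs_continuous_on_interval c d f"
proof (rule AC_I)
  fix e :: real assume "e > 0"
  from AC_D[OF assms(1) this] obtain r where r: "r > 0"
    "\<And>P. finite P \<Longrightarrow> (\<And>s t. (s, t) \<in> P \<Longrightarrow> a \<le> s \<and> s < t \<and> t \<le> b) \<Longrightarrow>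
       disjoint_family_on (\<lambda>(s, t). {s<..<t}) P \<Longrightarrow> (\<Sum>(s, t)\<in>P. t - s) < r \<Longrightarrow>
       (\<Sum>(s, t)\<in>P. \<bar>f t - f s\<bar>) < e" by blast
  show "\<exists>r>0. \<forall>P. finite P \<longrightarrow> (\<forall>s t. (s, t) \<in> P \<longrightarrow> c \<le> s \<and> s < t \<and> t \<le> d) \<longrightarrow>
        disjoint_family_on (\<lambda>(s, t). {s<..<t}) P \<longrightarrow> (\<Sum>(s, t)\<in>P. t - s) < r \<longrightarrow>
        (\<Sum>(s, t)\<in>P. \<bar>f t - f s\<bar>) < e"
    by (intro exI[of _ r] conjI allI impI r) (use assms(2,3) in force)+
qed

lemma AC_continuous_on:
  assumes "abs_continuous_on_interval a b f"
  shows "continuous_on {a..b} f"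
  unfolding continuous_on_iff
proof (intro ballI allI impI)
  fix x e :: real assume x: "x \<in> {a..b}" and e: "e > 0"
  from AC_D[OF assms e] obtain r where r: "r > 0"
    "\<And>P. finite P \<Longrightarrow> (\<And>s t. (s, t) \<in> P \<Longrightarrow> a \<le> s \<and> s < t \<and> t \<le> b) \<Longrightarrow>
       disjoint_family_on (\<lambda>(s, t). {s<..<t}) P \<Longrightarrow> (\<Sum>(s, t)\<in>P. t - s) < r \<Longrightarrow>
       (\<Sum>(s, t)\<in>P. \<bar>f t - f s\<bar>) < e" by blast
  have *: "\<bar>f t - f s\<bar> < e" if "a \<le> s" "s < t" "t \<le> b" "t - s < r" for s t
    using r(2)[of "{(s, t)}"] that by (auto simp: disjoint_family_on_def)
  have "dist (f y) (f x) < e" if "y \<in> {a..b}" "dist y x < r" for y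
    using *[of x y] *[of y x] that x e
    by (cases x y rule: linorder_cases) (auto simp: dist_real_def abs_minus_commute)
  then show "\<exists>d>0. \<forall>x'\<in>{a..b}. dist x' x < d \<longrightarrow> dist (f x') (f x) < e"
    using r(1) by blast
qed

lemma AC_compose_C1:
  assumes f: "abs_continuous_on_interval a b f" and im: "\<And>t. t \<in> {a..b} \<Longrightarrow> f t \<in> {m..M}"
    and der: "\<And>x. x \<in> {m..M} \<Longrightarrow> (g has_real_derivative g' x) (at x)"
    and cont: "continuous_on {m..M} g'"
  shows "abs_continuous_on_interval a b (\<lambda>t. g (f t))"
proof -
  have "bounded (g' ` {m..M})"
    by (intro compact_imp_bounded compact_continuous_image cont) simp
  then obtain B where B: "\<And>x. x \<in> {m..M} \<Longrightarrow> norm (g' x) \<le> B"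
    unfolding bounded_iff by blast
  show ?thesis
  proof (rule AC_dominated[OF f, where L = B])
    fix s t assume "a \<le> s" "s < t" "t \<le> b"
    then have "f t \<in> {m..M}" "f s \<in> {m..M}" using im[of t] im[of s] by auto
    then have "norm (g (f t) - g (f s)) \<le> B * norm (f t - f s)"
      by (intro field_differentiable_bound[where S = "{m..M}" and f' = g'] B
          has_field_derivative_at_within[OF der]) auto
    then show "\<bar>g (f t) - g (f s)\<bar> \<le> B * \<bar>f t - f s\<bar>" by simp
  qed
qed

lemma AC_of_bounded_derivative:
  fixes f :: "real \<Rightarrow> real"
  assumes K: "finite K" and cont: "continuous_on {a..b} f"
    and der: "\<And>x. x \<in> {a<..<b} - K \<Longrightarrow> (f has_real_derivative f' x) (at x)"
    and bd: "\<And>x. x \<in> {a<..<b} - K \<Longrightarrow> \<bar>f' x\<bar> \<le> B"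
  shows "abs_continuous_on_interval a b f"
proof (rule AC_dominated[OF AC_id, where L = "max B 0"])
  fix s t :: real assume st: "a \<le> s" "s < t" "t \<le> b"
  define h where "h x = (if x \<in> {a<..<b} - K then f' x else 0)" for x
  have "(h has_integral (f t - f s)) {s..t}"
  proof (rule fundamental_theorem_of_calculus_interior_strong[OF K])
    fix x assume "x \<in> {s<..<t} - K"
    then have "x \<in> {a<..<b} - K" using st by auto
    then show "(f has_vector_derivative h x) (at x)"
      using der[of x] by (simp add: h_def has_real_derivative_iff_has_vector_derivative)
  qed (use st cont in \<open>auto intro: continuous_on_subset\<close>)
  then have "(h has_integral (f t - f s)) (cbox s t)" by simp
  then have "norm (f t - f s) \<le> max B 0 * measure lborel (cbox s t)"
    by (rule has_integral_bound[rotated]) (use bd in \<open>force simp: h_def\<close>)+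
  then show "\<bar>f t - f s\<bar> \<le> max B 0 * \<bar>t - s\<bar>" using st by simp
qed

text \<open>
  A Cousin partition argument.  The gauge at a point outside the null set \<open>N\<close> makes the increment of
  \<open>f\<close> over a tagged interval at most \<open>e\<close> times its length; the gauge at a point of \<open>N\<close> keeps the
  interval inside an open set \<open>U \<supseteq> N\<close> of measure below the \<open>r\<close> that absolute continuity provides
  for \<open>e\<close>.  In a fine partition the good tags contribute at most \<open>e (b - a)\<close> to \<open>f b - f a\<close>, and
  the bad ones, whose intervals have total length less than \<open>r\<close>, at most \<open>e\<close>.
\<close>

lemma AC_nonincreasing:
  assumes ac: "abs_continuous_on_interval a b f" and N: "negligible N" and ab: "a \<le> b"
    and der: "\<And>t. t \<in> {a..b} - N \<Longrightarrow> \<exists>D\<le>0. (f has_real_derivative D) (at t within {a..b})"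
  shows "f b \<le> f a"
proof (rule field_le_epsilon)
  fix \<epsilon> :: real assume "\<epsilon> > 0"
  define e where "e = \<epsilon> / (b - a + 1)"
  have e: "e > 0" and "e * (b - a + 1) = \<epsilon>"
    using \<open>\<epsilon> > 0\<close> ab by (auto simp: e_def)
  then have e_eq: "e * (b - a) + e = \<epsilon>" by (simp add: distrib_left)
  obtain r where r: "r > 0"
    "\<And>P. finite P \<Longrightarrow> (\<And>s t. (s, t) \<in> P \<Longrightarrow> a \<le> s \<and> s < t \<and> t \<le> b) \<Longrightarrow>
       disjoint_family_on (\<lambda>(s, t). {s<..<t}) P \<Longrightarrow> (\<Sum>(s, t)\<in>P. t - s) < r \<Longrightarrow>
       (\<Sum>(s, t)\<in>P. \<bar>f t - f s\<bar>) < e"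
    using AC_D[OF ac e] by blast
  have Nl: "N \<in> null_sets lebesgue" using N negligible_iff_null_sets by blast
  then obtain U where U: "open U" "N \<subseteq> U" "U - N \<in> lmeasurable" "emeasure lebesgue (U - N) < ennreal r"
    using sets_lebesgue_outer_open[of N r] r(1) by blast
  have "emeasure lebesgue U = emeasure lebesgue (U - N)"
    using U(1) Nl by (simp add: emeasure_Diff_null_set borel_open)
  then have Ur: "emeasure lebesgue U < ennreal r" using U(4) by simp
  then have Ulm: "U \<in> lmeasurable"
    using U(1) by (intro fmeasurableI) (auto simp: borel_open intro: order_less_trans)
  have Umeas: "measure lebesgue U < r"
    using Ur r(1) Ulm by (simp add: emeasure_eq_measure2 ennreal_less_iff)
  have "\<exists>d>0. (t \<in> N \<longrightarrow> ball t d \<subseteq> U) \<and> (t \<in> {a..b} - N \<longrightarrow>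
     (\<forall>x y. a \<le> x \<longrightarrow> x \<le> t \<longrightarrow> t \<le> y \<longrightarrow> y \<le> b \<longrightarrow> x \<in> ball t d \<longrightarrow> y \<in> ball t d \<longrightarrow> f y - f x \<le> e * (y - x)))" for t
  proof (cases "t \<in> N")
    case True
    then show ?thesis using U(1,2) by (metis DiffD2 open_contains_ball subsetD)
  next
    case False
    show ?thesis
    proof (cases "t \<in> {a..b}")
      case True
      then obtain D where D: "D \<le> 0" "(f has_real_derivative D) (at t within {a..b})"
        using der False by blast
      then obtain d where d: "d > 0" "\<And>y. y \<in> {a..b} \<Longrightarrow> \<bar>y - t\<bar> < d \<Longrightarrow> \<bar>f y - f t - D * (y - t)\<bar> \<le> e * \<bar>y - t\<bar>"
        using e unfolding has_field_derivative_def has_derivative_within_alt by auto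
      have "f y - f x \<le> e * (y - x)" if "a \<le> x" "x \<le> t" "t \<le> y" "y \<le> b" "x \<in> ball t d" "y \<in> ball t d" for x y
      proof -
        have "f y - f t \<le> D * (y - t) + e * (y - t)"
          using d(2)[of y] that by (auto simp: dist_real_def)
        moreover have "f t - f x \<le> D * (t - x) + e * (t - x)"
          using d(2)[of x] that by (auto simp: dist_real_def algebra_simps)
        moreover have "D * (y - t) \<le> 0" "D * (t - x) \<le> 0"
          using D(1) that by (auto intro: mult_nonpos_nonneg)
        ultimately show ?thesis by (simp add: algebra_simps)
      qed
      then show ?thesis using d(1) False by blast
    qed (use False in \<open>auto intro: exI[of _ 1]\<close>)
  qed
  then obtain d where d: "\<And>t. d t > 0" "\<And>t. t \<in> N \<Longrightarrow> ball t (d t) \<subseteq> U"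
    "\<And>t x y. t \<in> {a..b} - N \<Longrightarrow> a \<le> x \<Longrightarrow> x \<le> t \<Longrightarrow> t \<le> y \<Longrightarrow> y \<le> b \<Longrightarrow> x \<in> ball t (d t) \<Longrightarrow> y \<in> ball t (d t)
      \<Longrightarrow> f y - f x \<le> e * (y - x)"
    by metis
  obtain p where p: "p tagged_division_of {a..b}" "(\<lambda>t. ball t (d t)) fine p"
    using fine_division_exists_real[of "\<lambda>t. ball t (d t)" a b] d(1) by (metis gauge_ball_dependent)
  have fin: "finite p" using p(1) by blast
  have pK: "\<exists>s t. K = {s..t} \<and> s \<le> x \<and> x \<le> t \<and> a \<le> s \<and> t \<le> b \<and> {s..t} \<subseteq> ball x (d x)"
    if "(x, K) \<in> p" for x K
  proof -
    obtain s t where K: "K = cbox s t" using tagged_division_ofD(4)[OF p(1) \<open>(x, K) \<in> p\<close>] by blast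
    have "x \<in> K" "K \<subseteq> {a..b}" "K \<subseteq> ball x (d x)"
      using tagged_division_ofD(2,3)[OF p(1) that] p(2) that by (auto simp: fine_def)
    then show ?thesis using K by (intro exI[of _ s] exI[of _ t]) auto
  qed
  (* q: the intervals with tag in N; q' discards the degenerate ones, which add nothing to the sum
     and do not correspond to pairs s < t.  Only nondegenerate intervals determine their tags. *)
  define q where "q = {(x, K) \<in> p. x \<in> N}"
  define q' where "q' = {(x, K) \<in> q. Inf K < Sup K}"
  define P where "P = (\<lambda>(x, K). (Inf K, Sup K)) ` q'"
  have q: "q \<subseteq> p" "finite q" "q' \<subseteq> q" "finite q'"
    using fin by (auto simp: q_def q'_def intro: finite_subset)
  have disj: "{Inf K<..<Sup K} \<inter> {Inf K'<..<Sup K'} = {}"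
    if "(x, K) \<in> q'" "(x', K') \<in> q'" "(x, K) \<noteq> (x', K')" for x K x' K'
  proof -
    have *: "(x, K) \<in> p" "(x', K') \<in> p" using that q by auto
    have "interior K \<inter> interior K' = {}" using tagged_division_ofD(5)[OF p(1) *] that(3) by blast
    then show ?thesis using pK[OF *(1)] pK[OF *(2)] by auto
  qed
  have inj: "inj_on (\<lambda>(x, K). (Inf K, Sup K)) q'"
  proof (rule inj_onI, clarify)
    fix x K x' K' assume *: "(x, K) \<in> q'" "(x', K') \<in> q'" "Inf K = Inf K'" "Sup K = Sup K'"
    have "{Inf K<..<Sup K} \<noteq> {}" using *(1) by (auto simp: q'_def)
    then show "x = x' \<and> K = K'" using disj[OF *(1,2)] *(3,4) by auto
  qed
  have P_sum: "(\<Sum>(s, t)\<in>P. h s t) = (\<Sum>(x, K)\<in>q'. h (Inf K) (Sup K))" for h :: "real \<Rightarrow> real \<Rightarrow> real"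
    unfolding P_def by (subst sum.reindex[OF inj]) (auto intro: sum.cong)
  have "(\<Sum>(s, t)\<in>P. \<bar>f t - f s\<bar>) < e"
  proof (rule r(2))
    show "finite P" using q by (simp add: P_def)
    show PD: "a \<le> s \<and> s < t \<and> t \<le> b" if "(s, t) \<in> P" for s t
    proof -
      obtain x K where K: "(x, K) \<in> q'" "s = Inf K" "t = Sup K" using \<open>(s, t) \<in> P\<close> by (auto simp: P_def)
      then have "(x, K) \<in> p" "s < t" using q by (auto simp: q'_def)
      then show ?thesis using pK[of x K] K by auto
    qed
    show dP: "disjoint_family_on (\<lambda>(s, t). {s<..<t}) P"
      unfolding disjoint_family_on_def P_def using disj by fastforce
    have PU: "{s<..<t} \<subseteq> U" if "(s, t) \<in> P" for s t
    proof -
      obtain x K where K: "(x, K) \<in> q'" "s = Inf K" "t = Sup K" using \<open>(s, t) \<in> P\<close> by (auto simp: P_def)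
      then have "(x, K) \<in> p" "x \<in> N" using q by (auto simp: q'_def q_def)
      then have "{s..t} \<subseteq> U" using pK[of x K] K d(2)[of x] by auto
      then show ?thesis by force
    qed
    have "(\<Sum>(s, t)\<in>P. t - s) = (\<Sum>i\<in>P. measure lebesgue ((\<lambda>(s, t). {s<..<t}) i))"
      using PD by (intro sum.cong) (auto simp: less_imp_le)
    also have "\<dots> = measure lebesgue (\<Union>i\<in>P. (\<lambda>(s, t). {s<..<t}) i)"
      by (rule measure_finite_Union[symmetric, OF \<open>finite P\<close> _ dP]) (use PD in \<open>auto simp: less_imp_le\<close>)
    also have "\<dots> \<le> measure lebesgue U"
      by (rule measure_mono_fmeasurable) (use PU Ulm \<open>finite P\<close> in \<open>auto intro!: sets.finite_UN\<close>)
    finally show "(\<Sum>(s, t)\<in>P. t - s) < r" using Umeas by simp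
  qed
  then have bad': "(\<Sum>(x, K)\<in>q'. \<bar>f (Sup K) - f (Inf K)\<bar>) < e" using P_sum[of "\<lambda>s t. \<bar>f t - f s\<bar>"] by simp
  have "(\<Sum>(x, K)\<in>q. f (Sup K) - f (Inf K)) = (\<Sum>(x, K)\<in>q'. f (Sup K) - f (Inf K))"
  proof (rule sum.mono_neutral_right[OF q(2,3)], clarify)
    fix x K assume "(x, K) \<in> q" "(x, K) \<notin> q'"
    then have "(x, K) \<in> p" "\<not> Inf K < Sup K" using q(1) by (auto simp: q'_def)
    then have "Inf K = Sup K" using pK[of x K] by auto
    then show "f (Sup K) - f (Inf K) = 0" by simp
  qed
  also have "\<dots> \<le> (\<Sum>(x, K)\<in>q'. \<bar>f (Sup K) - f (Inf K)\<bar>)" by (intro sum_mono) auto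
  finally have bad: "(\<Sum>(x, K)\<in>q. f (Sup K) - f (Inf K)) \<le> e" using bad' by simp
  have "(\<Sum>(x, K)\<in>p - q. f (Sup K) - f (Inf K)) \<le> (\<Sum>(x, K)\<in>p - q. e * (Sup K - Inf K))"
  proof (rule sum_mono, clarify)
    fix x K assume *: "(x, K) \<in> p" "(x, K) \<notin> q"
    obtain s t where K: "K = {s..t}" "s \<le> x" "x \<le> t" "a \<le> s" "t \<le> b" "{s..t} \<subseteq> ball x (d x)"
      using pK[OF *(1)] by blast
    have "s \<in> {s..t}" "t \<in> {s..t}" using K(2,3) by auto
    then have "s \<in> ball x (d x)" "t \<in> ball x (d x)" using K(6) by blast+
    moreover have "x \<in> {a..b} - N" using * K by (auto simp: q_def)
    ultimately show "f (Sup K) - f (Inf K) \<le> e * (Sup K - Inf K)" using d(3)[of x s t] K by simp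
  qed
  also have "\<dots> \<le> (\<Sum>(x, K)\<in>p. e * (Sup K - Inf K))"
  proof (rule sum_mono2[OF fin])
    fix z assume "z \<in> p - (p - q)"
    then obtain x K where "z = (x, K)" "(x, K) \<in> p" by (cases z) auto
    then show "0 \<le> (case z of (x, K) \<Rightarrow> e * (Sup K - Inf K))" using pK[of x K] e by auto
  qed blast
  also have "\<dots> = e * (\<Sum>(x, K)\<in>p. Sup K - Inf K)"
    by (simp add: sum_distrib_left case_prod_unfold)
  also have "\<dots> = e * (b - a)" using additive_tagged_division_1[OF ab p(1), of "\<lambda>x. x"] by simp
  finally have good: "(\<Sum>(x, K)\<in>p - q. f (Sup K) - f (Inf K)) \<le> e * (b - a)" .
  have "f b - f a = (\<Sum>(x, K)\<in>p. f (Sup K) - f (Inf K))"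
    using additive_tagged_division_1[OF ab p(1), of f] by simp
  also have "\<dots> = (\<Sum>(x, K)\<in>p - q. f (Sup K) - f (Inf K)) + (\<Sum>(x, K)\<in>q. f (Sup K) - f (Inf K))"
    by (rule sum.subset_diff[OF q(1) fin])
  finally show "f b \<le> f a + \<epsilon>" using good bad e_eq by linarith
qed

lemma AC_antimono:
  assumes ac: "abs_continuous_on_interval a b f" and N: "negligible N"
    and der: "\<And>t. t \<in> {a..b} - N \<Longrightarrow> \<exists>D\<le>0. (f has_real_derivative D) (at t within {a..b})"
    and st: "a \<le> s" "s \<le> t" "t \<le> b"
  shows "f t \<le> f s"
proof (rule AC_nonincreasing[OF AC_subinterval[OF ac] N st(2)])
  fix r assume r: "r \<in> {s..t} - N"
  then obtain D where "D \<le> 0" "(f has_real_derivative D) (at r within {a..b})"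
    using der[of r] st by auto
  then show "\<exists>D\<le>0. (f has_real_derivative D) (at r within {s..t})"
    using st by (intro exI[of _ D]) (auto intro: has_field_derivative_subset)
qed (use st in auto)

lemma AC_mono:
  assumes ac: "abs_continuous_on_interval a b f" and N: "negligible N"
    and der: "\<And>t. t \<in> {a..b} - N \<Longrightarrow> \<exists>D\<ge>0. (f has_real_derivative D) (at t within {a..b})"
    and st: "a \<le> s" "s \<le> t" "t \<le> b"
  shows "f s \<le> f t"
proof -
  have "- f t \<le> - f s"
  proof (rule AC_antimono[OF AC_minus[OF ac] N _ st])
    fix r assume "r \<in> {a..b} - N"
    then obtain D where "D \<ge> 0" "(f has_real_derivative D) (at r within {a..b})"
      using der by blast
    then show "\<exists>D\<le>0. ((\<lambda>t. - f t) has_real_derivative D) (at r within {a..b})"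
      by (intro exI[of _ "- D"]) (auto intro: DERIV_minus)
  qed
  then show ?thesis by simp
qed

text \<open>
  The difference of \<open>f\<close> and the integral of \<open>y\<close> is absolutely continuous with derivative zero
  almost everywhere, hence constant.  This removes the exceptional null set from \<open>x' = y\<close> along a
  trajectory.
\<close>

lemma AC_C1:
  assumes ac: "abs_continuous_on_interval a b f" and N: "negligible N"
    and y: "continuous_on {a..b} y"
    and der: "\<And>t. t \<in> {a..b} - N \<Longrightarrow> (f has_real_derivative y t) (at t within {a..b})"
    and t: "t \<in> {a<..<b}"
  shows "(f has_real_derivative y t) (at t)"
proof -
  define H where "H t = integral {a..t} y" for t
  have H: "(H has_real_derivative y t) (at t within {a..b})" if "t \<in> {a..b}" for t
    unfolding H_def using integral_has_real_derivative[OF y that] .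
  have H': "(H has_real_derivative y t) (at t)" if "t \<in> {a<..<b}" for t
    using H[of t] that by (auto simp: at_within_Icc_at)
  have "bounded (y ` {a..b})" by (intro compact_imp_bounded compact_continuous_image y) simp
  then obtain B where B: "\<And>t. t \<in> {a..b} \<Longrightarrow> \<bar>y t\<bar> \<le> B"
    unfolding bounded_iff real_norm_def by blast
  have "abs_continuous_on_interval a b H"
  proof (rule AC_of_bounded_derivative[where K = "{}" and B = B and f' = y])
    show "continuous_on {a..b} H"
      using H DERIV_continuous by (force simp: continuous_on_eq_continuous_within)
  qed (use H' B in auto)
  then have g: "abs_continuous_on_interval a b (\<lambda>t. f t + - H t)"
    by (intro AC_add AC_minus ac)
  have der0: "((\<lambda>t. f t + - H t) has_real_derivative 0) (at t within {a..b})" if "t \<in> {a..b} - N" for t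
    using DERIV_add[OF der[OF that] DERIV_minus[OF H[of t]]] that by simp
  have eq: "f t = H t + (f a + - H a)" if "t \<in> {a<..<b}" for t
  proof -
    have "f t + - H t \<le> f a + - H a"
      by (rule AC_antimono[OF g N]) (use der0 that in force)+
    moreover have "f a + - H a \<le> f t + - H t"
      by (rule AC_mono[OF g N]) (use der0 that in force)+
    ultimately show ?thesis by simp
  qed
  show ?thesis
  proof (rule has_field_derivative_transform_within_open[where S = "{a<..<b}"])
    show "((\<lambda>t. H t + (f a + - H a)) has_real_derivative y t) (at t)"
      using DERIV_add[OF H'[OF t] DERIV_const] by simp
  qed (use t eq in auto)
qed

section \<open>Two monotone quantities along trajectories\<close>

lemma AE_lebesgue_on_interval:
  fixes P :: "real \<Rightarrow> bool"
  assumes "AE t in lebesgue_on {a..b}. P t"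
  obtains N where "negligible N" "\<And>t. t \<in> {a..b} - N \<Longrightarrow> P t"
proof -
  have "AE t in lebesgue. t \<in> {a..b} \<longrightarrow> P t"
    using assms by (subst (asm) AE_restrict_space_iff) auto
  then obtain N where "N \<in> null_sets lebesgue" "{t. \<not> (t \<in> {a..b} \<longrightarrow> P t)} \<subseteq> N"
    unfolding eventually_ae_filter by auto
  then show ?thesis using that[of N] by (auto simp: negligible_iff_null_sets)
qed

lemma AE_lebesgue_on_intervalI:
  fixes P :: "real \<Rightarrow> bool"
  assumes "negligible N" "\<And>t. t \<in> {a..b} - N \<Longrightarrow> P t"
  shows "AE t in lebesgue_on {a..b}. P t"
proof -
  have "AE t in lebesgue. t \<in> {a..b} \<longrightarrow> P t"
    by (rule AE_I'[of N]) (use assms in \<open>auto simp: negligible_iff_null_sets\<close>)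
  then show ?thesis by (subst AE_restrict_space_iff) auto
qed

text \<open>
  The first integrals of the system for the constant controls \<open>u = -1\<close> and \<open>u = 1\<close> are monotone
  under every admissible control.
\<close>

lemma trajectory_monotone_quantities:
  assumes u: "admissible_control T u" and tr: "trajectory T u x y"
    and st: "0 \<le> s" "s \<le> t" "t \<le> T"
  shows "x s \<le> x t"
    and "(y t)\<^sup>2 - (x t)\<^sup>2 + 2 / x t \<le> (y s)\<^sup>2 - (x s)\<^sup>2 + 2 / x s"
    and "(y s)\<^sup>2 + (x s)\<^sup>2 + 2 / x s \<le> (y t)\<^sup>2 + (x t)\<^sup>2 + 2 / x t"
proof -
  have acx: "abs_continuous_on_interval 0 T x" and acy: "abs_continuous_on_interval 0 T y"
    using tr by (auto simp: trajectory_def)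
  have dom: "x t > 0" "y t \<ge> 0" if "t \<in> {0..T}" for t
    using tr that by (auto simp: trajectory_def state_domain_def)
  obtain N1 where N1: "negligible N1" "\<And>t. t \<in> {0..T} - N1 \<Longrightarrow> -1 \<le> u t \<and> u t \<le> 1"
    using u AE_lebesgue_on_interval unfolding admissible_control_def by blast
  obtain N2 where N2: "negligible N2" "\<And>t. t \<in> {0..T} - N2 \<Longrightarrow>
      (x has_real_derivative y t) (at t within {0..T}) \<and>
      (y has_real_derivative (- u t * x t + 1 / (x t)\<^sup>2)) (at t within {0..T})"
    using tr AE_lebesgue_on_interval unfolding trajectory_def by blast
  define N where "N = N1 \<union> N2"
  have N: "negligible N" using N1 N2 by (auto simp: N_def)
  have ut: "-1 \<le> u t" "u t \<le> 1" if "t \<in> {0..T} - N" for t using N1(2)[of t] that by (auto simp: N_def)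
  have dx: "(x has_real_derivative y t) (at t within {0..T})" if "t \<in> {0..T} - N" for t
    using N2(2)[of t] that by (auto simp: N_def)
  have dy: "(y has_real_derivative (- u t * x t + 1 / (x t)\<^sup>2)) (at t within {0..T})"
    if "t \<in> {0..T} - N" for t using N2(2)[of t] that by (auto simp: N_def)
  have mono: "x s \<le> x t" if "0 \<le> s" "s \<le> t" "t \<le> T" for s t
    by (rule AC_mono[OF acx N _ that]) (use dx dom(2) in blast)
  show "x s \<le> x t" using mono st by simp
  have xr: "x t \<in> {x 0..x T}" if "t \<in> {0..T}" for t using mono[of 0 t] mono[of t T] that by auto
  have pos: "x 0 > 0" using dom[of 0] st by auto
  have "bounded (y ` {0..T})"
    by (intro compact_imp_bounded compact_continuous_image AC_continuous_on acy) simp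
  then obtain M where M: "\<And>t. t \<in> {0..T} \<Longrightarrow> \<bar>y t\<bar> \<le> M"
    unfolding bounded_iff real_norm_def by blast
  have acy2: "abs_continuous_on_interval 0 T (\<lambda>t. (y t)\<^sup>2)"
    by (rule AC_compose_C1[OF acy, where m = "-M" and M = M and g' = "\<lambda>z. 2 * z"])
       (use M in \<open>force intro!: derivative_eq_intros continuous_intros simp: abs_le_iff\<close>)+
  have acx1: "abs_continuous_on_interval 0 T (\<lambda>t. - (x t)\<^sup>2 + 2 / x t)"
    by (rule AC_compose_C1[OF acx xr, where g' = "\<lambda>z. - 2 * z - 2 / z\<^sup>2"])
       (use pos in \<open>auto intro!: derivative_eq_intros continuous_intros simp: power2_eq_square\<close>)
  have acx2: "abs_continuous_on_interval 0 T (\<lambda>t. (x t)\<^sup>2 + 2 / x t)"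
    by (rule AC_compose_C1[OF acx xr, where g' = "\<lambda>z. 2 * z - 2 / z\<^sup>2"])
       (use pos in \<open>auto intro!: derivative_eq_intros continuous_intros simp: power2_eq_square\<close>)
  have "(y t)\<^sup>2 + (- (x t)\<^sup>2 + 2 / x t) \<le> (y s)\<^sup>2 + (- (x s)\<^sup>2 + 2 / x s)"
  proof (rule AC_antimono[OF AC_add[OF acy2 acx1] N _ st])
    fix t assume t: "t \<in> {0..T} - N"
    have p: "x t > 0" "y t \<ge> 0" using dom t by auto
    have "((\<lambda>t. (y t)\<^sup>2 + (- (x t)\<^sup>2 + 2 / x t)) has_real_derivative (- 2 * (y t * x t * (1 + u t))))
        (at t within {0..T})"
      using p by (auto intro!: derivative_eq_intros dx[OF t] dy[OF t] simp: field_simps power2_eq_square)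
    moreover have "0 \<le> y t * x t * (1 + u t)" using p ut[OF t] by simp
    ultimately show "\<exists>D\<le>0. ((\<lambda>t. (y t)\<^sup>2 + (- (x t)\<^sup>2 + 2 / x t)) has_real_derivative D) (at t within {0..T})"
      by (intro exI[of _ "- 2 * (y t * x t * (1 + u t))"]) auto
  qed
  then show "(y t)\<^sup>2 - (x t)\<^sup>2 + 2 / x t \<le> (y s)\<^sup>2 - (x s)\<^sup>2 + 2 / x s" by simp
  have "(y s)\<^sup>2 + ((x s)\<^sup>2 + 2 / x s) \<le> (y t)\<^sup>2 + ((x t)\<^sup>2 + 2 / x t)"
  proof (rule AC_mono[OF AC_add[OF acy2 acx2] N _ st])
    fix t assume t: "t \<in> {0..T} - N"
    have p: "x t > 0" "y t \<ge> 0" using dom t by auto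
    have "((\<lambda>t. (y t)\<^sup>2 + ((x t)\<^sup>2 + 2 / x t)) has_real_derivative (2 * (y t * x t * (1 - u t))))
        (at t within {0..T})"
      using p by (auto intro!: derivative_eq_intros dx[OF t] dy[OF t] simp: field_simps power2_eq_square)
    moreover have "0 \<le> y t * x t * (1 - u t)" using p ut[OF t] by simp
    ultimately show "\<exists>D\<ge>0. ((\<lambda>t. (y t)\<^sup>2 + ((x t)\<^sup>2 + 2 / x t)) has_real_derivative D) (at t within {0..T})"
      by (intro exI[of _ "2 * (y t * x t * (1 - u t))"]) auto
  qed
  then show "(y s)\<^sup>2 + (x s)\<^sup>2 + 2 / x s \<le> (y t)\<^sup>2 + (x t)\<^sup>2 + 2 / x t" by simp
qed

lemma trajectory_position_C1:
  assumes tr: "trajectory T u x y" and t: "t \<in> {0<..<T}"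
  shows "(x has_real_derivative y t) (at t)"
proof -
  obtain N where N: "negligible N" "\<And>t. t \<in> {0..T} - N \<Longrightarrow>
      (x has_real_derivative y t) (at t within {0..T}) \<and>
      (y has_real_derivative (- u t * x t + 1 / (x t)\<^sup>2)) (at t within {0..T})"
    using tr AE_lebesgue_on_interval unfolding trajectory_def by blast
  show ?thesis
    by (rule AC_C1[OF _ N(1) _ _ t]) (use tr N(2) in \<open>auto simp: trajectory_def AC_continuous_on\<close>)
qed

section \<open>Travel times along a line with a speed limit\<close>

lemma travel_time_properties:
  fixes v :: "real \<Rightarrow> real"
  assumes v: "continuous_on {a..b} v" "\<And>x. x \<in> {a<..<b} \<Longrightarrow> 0 < v x"
    and int: "(\<lambda>x. 1 / v x) integrable_on {a..b}"
  shows "continuous_on {a..b} (\<lambda>x. integral {a..x} (\<lambda>x. 1 / v x))"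
    and "x \<in> {a<..<b} \<Longrightarrow> ((\<lambda>x. integral {a..x} (\<lambda>x. 1 / v x)) has_real_derivative 1 / v x) (at x)"
proof -
  show "continuous_on {a..b} (\<lambda>x. integral {a..x} (\<lambda>x. 1 / v x))"
    by (rule indefinite_integral_continuous_1[OF int])
  assume x: "x \<in> {a<..<b}"
  have "continuous (at x within {a..b}) v"
    using v(1) x by (auto simp: continuous_on_eq_continuous_within)
  then have "continuous (at x within {a..b}) (\<lambda>x. 1 / v x)"
    using v(2)[OF x] by (intro continuous_at_within_divide) auto
  then have "((\<lambda>x. integral {a..x} (\<lambda>x. 1 / v x)) has_vector_derivative 1 / v x) (at x within {a..b})"
    using integral_has_vector_derivative_continuous_at[OF int, of x "{}"] x by auto
  then show "((\<lambda>x. integral {a..x} (\<lambda>x. 1 / v x)) has_real_derivative 1 / v x) (at x)"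
    using x by (auto simp: has_real_derivative_iff_has_vector_derivative at_within_Icc_at)
qed

text \<open>
  With \<open>F\<close> the integral of \<open>1 / v\<close> from \<open>a\<close>, the function \<open>t - F (x t)\<close> is nondecreasing while
  \<open>x t\<close> is strictly between \<open>a\<close> and \<open>b\<close>.  At the ends \<open>v\<close> may vanish and \<open>F\<close> may fail to be
  differentiable, and \<open>x\<close> may rest there, so the argument only runs from the last time \<open>p\<close> at \<open>a\<close>
  to the first later time \<open>q\<close> at \<open>b\<close>.
\<close>

lemma travel_time_lower_bound:
  fixes v x y :: "real \<Rightarrow> real"
  assumes v: "continuous_on {a..b} v" "\<And>x. x \<in> {a<..<b} \<Longrightarrow> 0 < v x"
    and int: "(\<lambda>x. 1 / v x) integrable_on {a..b}"
    and ab: "a < b" and S: "0 \<le> S"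
    and x: "continuous_on {0..S} x" "x 0 = a" "x S = b"
    and dx: "\<And>t. t \<in> {0<..<S} \<Longrightarrow> (x has_real_derivative y t) (at t)"
    and bd: "\<And>t. t \<in> {0..S} \<Longrightarrow> x t \<in> {a..b} \<and> y t \<le> v (x t)"
  shows "integral {a..b} (\<lambda>x. 1 / v x) \<le> S"
proof -
  define F where "F x = integral {a..x} (\<lambda>x. 1 / v x)" for x
  have F: "continuous_on {a..b} F" "\<And>x. x \<in> {a<..<b} \<Longrightarrow> (F has_real_derivative 1 / v x) (at x)"
    unfolding F_def by (auto intro!: travel_time_properties v int)
  define A where "A = {t \<in> {0..S}. x t = a}"
  have "closed A" unfolding A_def using x(1) by (intro continuous_closed_preimage_constant) auto
  moreover have "bounded A" by (rule bounded_subset[of "{0..S}"]) (auto simp: A_def)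
  ultimately have "compact A" by (simp add: compact_eq_bounded_closed)
  then obtain p where p: "p \<in> A" "\<And>t. t \<in> A \<Longrightarrow> t \<le> p"
    using compact_attains_sup[of A] x S by (auto simp: A_def)
  define B where "B = {t \<in> {p..S}. x t = b}"
  have "closed B" unfolding B_def
    using p(1) by (intro continuous_closed_preimage_constant continuous_on_subset[OF x(1)]) (auto simp: A_def)
  moreover have "bounded B" by (rule bounded_subset[of "{p..S}"]) (auto simp: B_def)
  ultimately have "compact B" by (simp add: compact_eq_bounded_closed)
  then obtain q where q: "q \<in> B" "\<And>t. t \<in> B \<Longrightarrow> q \<le> t"
    using compact_attains_inf[of B] x p(1) by (auto simp: A_def B_def)
  have pq: "0 \<le> p" "p \<le> q" "q \<le> S" "x p = a" "x q = b" using p q by (auto simp: A_def B_def)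
  have inside: "x t \<in> {a<..<b}" if "p < t" "t < q" for t
  proof -
    have "t \<notin> A" "t \<notin> B" using p(2)[of t] q(2)[of t] that by auto
    then show ?thesis using bd[of t] that pq by (auto simp: A_def B_def order.order_iff_strict)
  qed
  have "p - F (x p) \<le> q - F (x q)"
  proof (rule DERIV_nonneg_imp_increasing_open[OF pq(2)])
    fix t assume t: "p < t" "t < q"
    have "((\<lambda>t. t - F (x t)) has_real_derivative 1 - 1 / v (x t) * y t) (at t)"
      using t pq by (intro DERIV_diff DERIV_ident DERIV_chain2[where f = F and g = x, OF F(2)[OF inside[OF t]]] dx) auto
    moreover have "0 < v (x t)" "y t \<le> v (x t)" using v(2)[OF inside[OF t]] bd[of t] t pq by auto
    ultimately show "\<exists>z. ((\<lambda>t. t - F (x t)) has_real_derivative z) (at t) \<and> 0 \<le> z"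
      by (intro exI[of _ "1 - 1 / v (x t) * y t"]) (auto simp: field_simps)
  next
    show "continuous_on {p..q} (\<lambda>t. t - F (x t))"
      by (intro continuous_on_diff continuous_on_id continuous_on_compose2[OF F(1), of _ x] continuous_on_subset[OF x(1)])
         (use bd pq in auto)
  qed
  then have "F b \<le> F a + (q - p)" using pq by simp
  also have "F a = 0" by (simp add: F_def)
  finally show ?thesis using pq by (simp add: F_def)
qed

text \<open>
  The solution of \<open>x' = v x\<close> is the inverse of the travel time \<open>F\<close>.  When \<open>v a = 0\<close> this initial
  value problem also has the constant solution; integrability of \<open>1 / v\<close> is what lets this solution
  leave \<open>a\<close> at once and arrive at \<open>b\<close> in finite time.
\<close>

lemma travel_at_prescribed_speed:
  fixes v :: "real \<Rightarrow> real"
  assumes v: "continuous_on {a..b} v" "\<And>x. x \<in> {a<..<b} \<Longrightarrow> 0 < v x"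
    and int: "(\<lambda>x. 1 / v x) integrable_on {a..b}"
    and ab: "a < b"
    and T: "T = integral {a..b} (\<lambda>x. 1 / v x)"
  obtains x where "0 < T" "continuous_on {0..T} x" "inj_on x {0..T}" "x 0 = a" "x T = b"
    "\<And>t. t \<in> {0..T} \<Longrightarrow> x t \<in> {a..b}"
    "\<And>t. t \<in> {0<..<T} \<Longrightarrow> x t \<in> {a<..<b}"
    "\<And>t. t \<in> {0<..<T} \<Longrightarrow> (x has_real_derivative v (x t)) (at t)"
proof -
  define F where "F x = integral {a..x} (\<lambda>x. 1 / v x)" for x
  have F: "continuous_on {a..b} F" "\<And>x. x \<in> {a<..<b} \<Longrightarrow> (F has_real_derivative 1 / v x) (at x)"
    unfolding F_def by (auto intro!: travel_time_properties v int)
  have F0: "F a = 0" and FT: "F b = T" by (auto simp: F_def T)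
  have less: "F s < F t" if "a \<le> s" "s < t" "t \<le> b" for s t
  proof (rule DERIV_pos_imp_increasing_open[OF that(2)])
    fix x assume "s < x" "x < t"
    then have "x \<in> {a<..<b}" using that by auto
    then show "\<exists>y. (F has_real_derivative y) (at x) \<and> 0 < y"
      using F(2)[of x] v(2)[of x] by (intro exI[of _ "1 / v x"]) auto
  qed (use that in \<open>auto intro: continuous_on_subset[OF F(1)]\<close>)
  have inj: "inj_on F {a..b}"
    by (rule linorder_inj_onI) (use less in \<open>force+\<close>)
  have T0: "0 < T" using less[of a b] ab F0 FT by simp
  have img: "F ` {a..b} = {0..T}"
  proof
    show "F ` {a..b} \<subseteq> {0..T}"
    proof clarify
      fix x assume "x \<in> {a..b}"
      then show "F x \<in> {0..T}" using less[of a x] less[of x b] F0 FT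
        by (cases "x = a"; cases "x = b") (auto simp: less_imp_le)
    qed
    show "{0..T} \<subseteq> F ` {a..b}"
      using IVT'[of F a _ b] F0 FT F(1) ab by (force simp: image_iff)
  qed
  define x where "x = the_inv_into {a..b} F"
  have xF: "x (F z) = z" if "z \<in> {a..b}" for z
    using the_inv_into_f_f[OF inj that] by (simp add: x_def)
  have Fx: "F (x t) = t" if "t \<in> {0..T}" for t
    using f_the_inv_into_f[OF inj, of t] that img by (simp add: x_def)
  have cont: "continuous_on {0..T} x"
    using continuous_on_inv_into[OF F(1) _ inj] img by (simp add: x_def)
  have xr: "x t \<in> {a..b}" if "t \<in> {0..T}" for t
    using the_inv_into_into[OF inj, of t "{a..b}"] that img by (simp add: x_def)
  have xi: "x t \<in> {a<..<b}" if "t \<in> {0<..<T}" for t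
    using xr[of t] Fx[of t] F0 FT that by (auto simp: order.order_iff_strict)
  show ?thesis
  proof (rule that[OF T0 cont])
    show "inj_on x {0..T}" by (rule inj_on_inverseI[of _ F]) (rule Fx)
    show "x 0 = a" "x T = b" using xF[of a] xF[of b] F0 FT ab by auto
    show "(x has_real_derivative v (x t)) (at t)" if t: "t \<in> {0<..<T}" for t
    proof -
      have "(x has_real_derivative inverse (1 / v (x t))) (at t)"
      proof (rule DERIV_inverse_function[where f = F and a = 0 and b = T])
        show "(F has_real_derivative 1 / v (x t)) (at (x t))" by (rule F(2)[OF xi[OF t]])
        show "isCont x t" using cont t by (auto intro: continuous_on_interior)
      qed (use v(2)[OF xi[OF t]] t Fx in auto)
      then show ?thesis by simp
    qed
  qed (use xr xi in auto)
qed

section \<open>Integrals with an inverse square root singularity\<close>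

lemma integrable_continuous_times_nonneg:
  fixes g h :: "real \<Rightarrow> real"
  assumes h: "continuous_on {a..b} h" and g: "g integrable_on {a..b}" "\<And>x. x \<in> {a..b} \<Longrightarrow> 0 \<le> g x"
  shows "(\<lambda>x. h x * g x) integrable_on {a..b}"
proof -
  have "(\<lambda>x. h x * g x) absolutely_integrable_on {a..b}"
  proof (rule absolutely_integrable_bounded_measurable_product_real)
    show "h \<in> borel_measurable (lebesgue_on {a..b})"
      by (intro continuous_imp_measurable_on_sets_lebesgue h) simp
    show "bounded (h ` {a..b})"
      by (intro compact_imp_bounded compact_continuous_image h) simp
    show "g absolutely_integrable_on {a..b}"
      by (rule nonnegative_absolutely_integrable_1[OF g])
  qed simp
  then show ?thesis by (rule set_lebesgue_integral_eq_integral(1))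
qed

lemma integrable_inverse_sqrt_left:
  fixes a b :: real
  assumes "a \<le> b"
  shows "(\<lambda>x. 1 / sqrt (x - a)) integrable_on {a..b}"
proof -
  have "((\<lambda>x. 1 / sqrt (x - a)) has_integral (2 * sqrt (b - a) - 2 * sqrt (a - a))) {a..b}"
  proof (rule fundamental_theorem_of_calculus_interior[OF assms])
    fix x assume "x \<in> {a<..<b}"
    then show "((\<lambda>x. 2 * sqrt (x - a)) has_vector_derivative 1 / sqrt (x - a)) (at x)"
      unfolding has_real_derivative_iff_has_vector_derivative[symmetric]
      by (auto intro!: derivative_eq_intros simp: field_simps)
  qed (auto intro!: continuous_intros)
  then show ?thesis by blast
qed

lemma integrable_inverse_sqrt_right:
  fixes a b :: real
  assumes "a \<le> b"
  shows "(\<lambda>x. 1 / sqrt (b - x)) integrable_on {a..b}"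
proof -
  have "((\<lambda>x. 1 / sqrt (b - x)) has_integral (- 2 * sqrt (b - b) - - 2 * sqrt (b - a))) {a..b}"
  proof (rule fundamental_theorem_of_calculus_interior[OF assms])
    fix x assume "x \<in> {a<..<b}"
    then show "((\<lambda>x. - 2 * sqrt (b - x)) has_vector_derivative 1 / sqrt (b - x)) (at x)"
      unfolding has_real_derivative_iff_has_vector_derivative[symmetric]
      by (auto intro!: derivative_eq_intros simp: field_simps)
  qed (auto intro!: continuous_intros)
  then show ?thesis by blast
qed

section \<open>The speed limit of the transfer problem\<close>

text \<open>
  The first term under the root is the squared velocity on the \<open>u = -1\<close> orbit through \<open>(1, 0)\<close>, the
  second that on the \<open>u = 1\<close> orbit through \<open>(\<gamma>, 0)\<close>.
\<close>

definition top_speed :: "real \<Rightarrow> real \<Rightarrow> real" where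
  "top_speed \<gamma> x = sqrt (min (x\<^sup>2 - 2 / x + 1) (\<gamma>\<^sup>2 + 2 / \<gamma> - x\<^sup>2 - 2 / x))"

lemma sqrt_chain_factor: "inverse w / 2 * (2 * d) = d / w" for d w :: real
  by (simp add: field_simps)

locale transfer =
  fixes \<gamma> \<beta> :: real
  assumes gamma: "\<gamma> > 1"
    and beta: "\<beta> = sqrt ((\<gamma> ^ 3 - \<gamma> + 2) / (2 * \<gamma>))"
begin

text \<open>
  At \<open>\<beta>\<close> the two terms of \<open>top_speed\<close> coincide.
\<close>

lemma beta_square: "2 * \<beta>\<^sup>2 = \<gamma>\<^sup>2 + 2 / \<gamma> - 1"
proof -
  have "\<gamma> ^ 3 - \<gamma> + 2 \<ge> 0"
    using gamma power_increasing[of 1 3 \<gamma>] by simp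
  then have sq: "\<beta>\<^sup>2 = (\<gamma> ^ 3 - \<gamma> + 2) / (2 * \<gamma>)" using gamma by (simp add: beta)
  show ?thesis unfolding sq using gamma
    by (simp add: divide_simps, simp add: algebra_simps power2_eq_square power3_eq_cube)
qed

lemma beta_bounds: "1 < \<beta>" "\<beta> < \<gamma>"
proof -
  have "2 * \<beta>\<^sup>2 - 2 = (\<gamma> - 1)\<^sup>2 * (\<gamma> + 2) / \<gamma>"
    unfolding beta_square using gamma by (simp add: divide_simps, simp add: algebra_simps power2_eq_square)
  also have "\<dots> > 0" using gamma by simp
  finally have "1\<^sup>2 < \<beta>\<^sup>2" by simp
  then show "1 < \<beta>" by (rule power2_less_imp_less) (use gamma power_increasing[of 1 3 \<gamma>] in \<open>simp add: beta\<close>)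
  have "2 * \<gamma>\<^sup>2 - 2 * \<beta>\<^sup>2 = (\<gamma> - 1) * (\<gamma>\<^sup>2 + \<gamma> + 2) / \<gamma>"
    unfolding beta_square using gamma by (simp add: divide_simps, simp add: algebra_simps power2_eq_square)
  also have "\<dots> > 0" using gamma by (simp add: add_pos_pos)
  finally have "\<beta>\<^sup>2 < \<gamma>\<^sup>2" by simp
  then show "\<beta> < \<gamma>" by (rule power2_less_imp_less) (use gamma in simp)
qed

lemma accelerating_factored:
  fixes x :: real
  assumes "x > 0" shows "x\<^sup>2 - 2 / x + 1 = (x - 1) * (x\<^sup>2 + x + 2) / x"
  using assms by (simp add: divide_simps, simp add: algebra_simps power2_eq_square)

lemma braking_factored:
  assumes "x > 0"
  shows "\<gamma>\<^sup>2 + 2 / \<gamma> - x\<^sup>2 - 2 / x = (\<gamma> - x) * (x\<^sup>2 + \<gamma> * x - 2 / \<gamma>) / x"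
  using assms gamma by (simp add: divide_simps, simp add: algebra_simps power2_eq_square)

lemma braking_factor_pos:
  assumes "1 \<le> x" shows "x\<^sup>2 + \<gamma> * x - 2 / \<gamma> > 0"
proof -
  have "1 \<le> x\<^sup>2" using assms by simp
  moreover have "\<gamma> * 1 \<le> \<gamma> * x" using gamma assms by (intro mult_left_mono) auto
  moreover have "2 / \<gamma> < 2" using gamma by (simp add: field_simps)
  ultimately show ?thesis using gamma by linarith
qed

lemma top_speed_accelerating:
  assumes "0 < x" "x \<le> \<beta>"
  shows "top_speed \<gamma> x = sqrt (x\<^sup>2 - 2 / x + 1)"
proof -
  have "x\<^sup>2 \<le> \<beta>\<^sup>2" using assms by (intro power_mono) auto
  then show ?thesis using beta_square by (simp add: top_speed_def min_def)
qed

lemma top_speed_braking: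
  assumes "\<beta> \<le> x"
  shows "top_speed \<gamma> x = sqrt (\<gamma>\<^sup>2 + 2 / \<gamma> - x\<^sup>2 - 2 / x)"
proof -
  have "\<beta>\<^sup>2 \<le> x\<^sup>2" using assms beta_bounds by (intro power_mono) auto
  then show ?thesis using beta_square by (auto simp: top_speed_def min_def)
qed

lemma top_speed_pos:
  assumes "x \<in> {1<..<\<gamma>}" shows "0 < top_speed \<gamma> x"
proof -
  have "0 < x\<^sup>2 - 2 / x + 1"
    using assms by (subst accelerating_factored) (auto simp: add_pos_pos)
  moreover have "0 < \<gamma>\<^sup>2 + 2 / \<gamma> - x\<^sup>2 - 2 / x"
    using assms braking_factor_pos[of x] by (subst braking_factored) auto
  ultimately show ?thesis by (simp add: top_speed_def)
qed

lemma top_speed_ends: "top_speed \<gamma> 1 = 0" "top_speed \<gamma> \<gamma> = 0"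
  using top_speed_accelerating[of 1] top_speed_braking[of \<gamma>] beta_bounds by auto

lemma continuous_on_top_speed: "continuous_on {1..\<gamma>} (top_speed \<gamma>)"
  unfolding top_speed_def using gamma by (auto intro!: continuous_intros)

lemma top_speed_derivative_accelerating:
  assumes "x \<in> {1<..<\<beta>}"
  shows "(top_speed \<gamma> has_real_derivative (x + 1 / x\<^sup>2) / top_speed \<gamma> x) (at x)"
proof (rule has_field_derivative_transform_within_open[where S = "{1<..<\<beta>}"])
  have v: "top_speed \<gamma> x = sqrt (x\<^sup>2 - 2 / x + 1)" "0 < top_speed \<gamma> x"
    using assms top_speed_accelerating[of x] top_speed_pos[of x] beta_bounds by auto
  have "((\<lambda>x. x\<^sup>2 - 2 / x + 1) has_real_derivative 2 * (x + 1 / x\<^sup>2)) (at x)"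
    using assms by (auto intro!: derivative_eq_intros simp: power2_eq_square)
  moreover have "0 < x\<^sup>2 - 2 / x + 1" using v by simp
  ultimately have "((\<lambda>x. sqrt (x\<^sup>2 - 2 / x + 1)) has_real_derivative
      inverse (sqrt (x\<^sup>2 - 2 / x + 1)) / 2 * (2 * (x + 1 / x\<^sup>2))) (at x)"
    by (intro DERIV_chain2[where f = sqrt] DERIV_real_sqrt)
  then show "((\<lambda>x. sqrt (x\<^sup>2 - 2 / x + 1)) has_real_derivative (x + 1 / x\<^sup>2) / top_speed \<gamma> x) (at x)"
    unfolding v(1) sqrt_chain_factor .
qed (use assms top_speed_accelerating in auto)

lemma top_speed_derivative_braking:
  assumes "x \<in> {\<beta><..<\<gamma>}"
  shows "(top_speed \<gamma> has_real_derivative (- x + 1 / x\<^sup>2) / top_speed \<gamma> x) (at x)"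
proof (rule has_field_derivative_transform_within_open[where S = "{\<beta><..<\<gamma>}"])
  have v: "top_speed \<gamma> x = sqrt (\<gamma>\<^sup>2 + 2 / \<gamma> - x\<^sup>2 - 2 / x)" "0 < top_speed \<gamma> x"
    using assms top_speed_braking[of x] top_speed_pos[of x] beta_bounds by auto
  have "((\<lambda>x. \<gamma>\<^sup>2 + 2 / \<gamma> - x\<^sup>2 - 2 / x) has_real_derivative 2 * (- x + 1 / x\<^sup>2)) (at x)"
    using assms beta_bounds by (auto intro!: derivative_eq_intros simp: power2_eq_square)
  moreover have "0 < \<gamma>\<^sup>2 + 2 / \<gamma> - x\<^sup>2 - 2 / x" using v by simp
  ultimately have "((\<lambda>x. sqrt (\<gamma>\<^sup>2 + 2 / \<gamma> - x\<^sup>2 - 2 / x)) has_real_derivative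
      inverse (sqrt (\<gamma>\<^sup>2 + 2 / \<gamma> - x\<^sup>2 - 2 / x)) / 2 * (2 * (- x + 1 / x\<^sup>2))) (at x)"
    by (intro DERIV_chain2[where f = sqrt] DERIV_real_sqrt)
  then show "((\<lambda>x. sqrt (\<gamma>\<^sup>2 + 2 / \<gamma> - x\<^sup>2 - 2 / x)) has_real_derivative (- x + 1 / x\<^sup>2) / top_speed \<gamma> x) (at x)"
    unfolding v(1) sqrt_chain_factor .
qed (use assms top_speed_braking in auto)

text \<open>
  The point \<open>x = 1\<close> is included because both sides are \<open>0\<close> there by the convention for division
  by zero; the same applies to \<open>x = \<gamma>\<close> below.
\<close>

lemma inverse_top_speed_accelerating:
  assumes "x \<in> {1..\<beta>}"
  shows "1 / top_speed \<gamma> x = sqrt (x / ((x - 1) * (x\<^sup>2 + x + 2)))"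
  using assms by (simp add: top_speed_accelerating accelerating_factored real_sqrt_divide)

lemma inverse_top_speed_braking:
  assumes "x \<in> {\<beta>..\<gamma>}"
  shows "1 / top_speed \<gamma> x = sqrt (x / ((\<gamma> - x) * (x\<^sup>2 + \<gamma> * x - 2 / \<gamma>)))"
  using assms beta_bounds by (simp add: top_speed_braking braking_factored real_sqrt_divide)

lemma integrable_accelerating:
  "(\<lambda>x. sqrt (x / ((x - 1) * (x\<^sup>2 + x + 2)))) integrable_on {1..\<beta>}"
proof -
  have ne: "x\<^sup>2 + x + 2 \<noteq> 0" if "1 \<le> x" for x :: real
    using that zero_le_power2[of x] by linarith
  have "(\<lambda>x. sqrt (x / (x\<^sup>2 + x + 2)) * (1 / sqrt (x - 1))) integrable_on {1..\<beta>}"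
  proof (rule integrable_continuous_times_nonneg)
    show "continuous_on {1..\<beta>} (\<lambda>x. sqrt (x / (x\<^sup>2 + x + 2)))"
      by (intro continuous_intros) (use ne in auto)
    show "(\<lambda>x. 1 / sqrt (x - 1)) integrable_on {1..\<beta>}"
      using beta_bounds by (intro integrable_inverse_sqrt_left) simp
  qed simp
  also have "(\<lambda>x. sqrt (x / (x\<^sup>2 + x + 2)) * (1 / sqrt (x - 1))) =
      (\<lambda>x. sqrt (x / ((x - 1) * (x\<^sup>2 + x + 2))))"
    by (simp only: real_sqrt_divide real_sqrt_mult times_divide_times_eq mult_1_left mult_1_right mult.commute)
  finally show ?thesis .
qed

lemma integrable_braking:
  "(\<lambda>x. sqrt (x / ((\<gamma> - x) * (x\<^sup>2 + \<gamma> * x - 2 / \<gamma>)))) integrable_on {\<beta>..\<gamma>}"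
proof -
  have ne: "x\<^sup>2 + \<gamma> * x - 2 / \<gamma> \<noteq> 0" if "\<beta> \<le> x" for x
    using braking_factor_pos[of x] that beta_bounds by simp
  have "(\<lambda>x. sqrt (x / (x\<^sup>2 + \<gamma> * x - 2 / \<gamma>)) * (1 / sqrt (\<gamma> - x))) integrable_on {\<beta>..\<gamma>}"
  proof (rule integrable_continuous_times_nonneg)
    show "continuous_on {\<beta>..\<gamma>} (\<lambda>x. sqrt (x / (x\<^sup>2 + \<gamma> * x - 2 / \<gamma>)))"
      by (intro continuous_intros) (use ne gamma in auto)
    show "(\<lambda>x. 1 / sqrt (\<gamma> - x)) integrable_on {\<beta>..\<gamma>}"
      using beta_bounds by (intro integrable_inverse_sqrt_right) simp
  qed simp
  also have "(\<lambda>x. sqrt (x / (x\<^sup>2 + \<gamma> * x - 2 / \<gamma>)) * (1 / sqrt (\<gamma> - x))) =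
      (\<lambda>x. sqrt (x / ((\<gamma> - x) * (x\<^sup>2 + \<gamma> * x - 2 / \<gamma>))))"
    by (simp only: real_sqrt_divide real_sqrt_mult times_divide_times_eq mult_1_left mult_1_right mult.commute)
  finally show ?thesis .
qed

lemma inverse_top_speed_has_integral:
  "((\<lambda>x. 1 / top_speed \<gamma> x) has_integral
     integral {1..\<beta>} (\<lambda>x. sqrt (x / ((x - 1) * (x\<^sup>2 + x + 2)))) +
     integral {\<beta>..\<gamma>} (\<lambda>x. sqrt (x / ((\<gamma> - x) * (x\<^sup>2 + \<gamma> * x - 2 / \<gamma>))))) {1..\<gamma>}"
proof (rule has_integral_combine)
  show "((\<lambda>x. 1 / top_speed \<gamma> x) has_integral
     integral {1..\<beta>} (\<lambda>x. sqrt (x / ((x - 1) * (x\<^sup>2 + x + 2))))) {1..\<beta>}"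
    by (rule has_integral_eq[OF _ integrable_integral[OF integrable_accelerating]])
      (simp only: inverse_top_speed_accelerating)
  show "((\<lambda>x. 1 / top_speed \<gamma> x) has_integral
     integral {\<beta>..\<gamma>} (\<lambda>x. sqrt (x / ((\<gamma> - x) * (x\<^sup>2 + \<gamma> * x - 2 / \<gamma>))))) {\<beta>..\<gamma>}"
    by (rule has_integral_eq[OF _ integrable_integral[OF integrable_braking]])
      (simp only: inverse_top_speed_braking)
qed (use beta_bounds in auto)

section \<open>The minimum time\<close>

lemma transfer_time_lower_bound:
  assumes "S \<in> transfer_times (1, 0) (\<gamma>, 0)"
  shows "integral {1..\<gamma>} (\<lambda>x. 1 / top_speed \<gamma> x) \<le> S"
proof -
  obtain u x y where S: "0 \<le> S" and u: "admissible_control S u" and tr: "trajectory S u x y"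
    and ends: "x 0 = 1" "y 0 = 0" "x S = \<gamma>" "y S = 0"
    using assms unfolding transfer_times_def by auto
  note mono = trajectory_monotone_quantities[OF u tr]
  show ?thesis
  proof (rule travel_time_lower_bound[where x = x and y = y, OF continuous_on_top_speed top_speed_pos _ gamma S])
    show "(\<lambda>x. 1 / top_speed \<gamma> x) integrable_on {1..\<gamma>}"
      by (rule has_integral_integrable[OF inverse_top_speed_has_integral])
    show "continuous_on {0..S} x" using tr by (simp add: trajectory_def AC_continuous_on)
    show "(x has_real_derivative y t) (at t)" if "t \<in> {0<..<S}" for t
      by (rule trajectory_position_C1[OF tr that])
    show "x t \<in> {1..\<gamma>} \<and> y t \<le> top_speed \<gamma> (x t)" if t: "t \<in> {0..S}" for t
    proof -
      have "(y t)\<^sup>2 \<le> (x t)\<^sup>2 - 2 / x t + 1" using mono(2)[of 0 t] t ends by simp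
      moreover have "(y t)\<^sup>2 \<le> \<gamma>\<^sup>2 + 2 / \<gamma> - (x t)\<^sup>2 - 2 / x t" using mono(3)[of t S] t ends by simp
      ultimately have "y t \<le> top_speed \<gamma> (x t)"
        unfolding top_speed_def by (intro real_le_rsqrt min.boundedI)
      moreover have "x t \<in> {1..\<gamma>}" using mono(1)[of 0 t] mono(1)[of t S] t ends by simp
      ultimately show ?thesis by simp
    qed
  qed (use ends in simp_all)
qed

text \<open>
  The state equations hold strictly between the end times, except at the switching time, where \<open>x\<close>
  passes \<open>\<beta>\<close> and the acceleration jumps; a bounded derivative off a finite set still gives absolute
  continuity.
\<close>

lemma transfer_time_attained:
  "integral {1..\<gamma>} (\<lambda>x. 1 / top_speed \<gamma> x) \<in> transfer_times (1, 0) (\<gamma>, 0)"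
proof -
  define T where "T = integral {1..\<gamma>} (\<lambda>x. 1 / top_speed \<gamma> x)"
  have int: "(\<lambda>x. 1 / top_speed \<gamma> x) integrable_on {1..\<gamma>}"
    by (rule has_integral_integrable[OF inverse_top_speed_has_integral])
  obtain x where T: "0 < T" and x: "continuous_on {0..T} x" "inj_on x {0..T}" "x 0 = 1" "x T = \<gamma>"
    "\<And>t. t \<in> {0..T} \<Longrightarrow> x t \<in> {1..\<gamma>}" "\<And>t. t \<in> {0<..<T} \<Longrightarrow> x t \<in> {1<..<\<gamma>}"
    "\<And>t. t \<in> {0<..<T} \<Longrightarrow> (x has_real_derivative top_speed \<gamma> (x t)) (at t)"
    using travel_at_prescribed_speed[OF continuous_on_top_speed top_speed_pos int gamma T_def] by blast
  define y where "y t = top_speed \<gamma> (x t)" for t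
  define u where "u t = (if x t \<le> \<beta> then -1 else 1 :: real)" for t
  define K where "K = {t \<in> {0..T}. x t = \<beta>}"
  have K: "finite K"
  proof (rule finite_imageD)
    show "finite (x ` K)" by (rule finite_subset[of _ "{\<beta>}"]) (auto simp: K_def)
    show "inj_on x K" by (rule inj_on_subset[OF x(2)]) (auto simp: K_def)
  qed
  have y_nonneg: "0 \<le> y t" if "t \<in> {0..T}" for t
    using top_speed_pos[of "x t"] top_speed_ends x(5)[OF that]
    by (cases "x t = 1 \<or> x t = \<gamma>") (auto simp: y_def less_imp_le)
  have y_cont: "continuous_on {0..T} y"
    unfolding y_def by (rule continuous_on_compose2[OF continuous_on_top_speed x(1)]) (use x(5) in auto)
  have dx: "(x has_real_derivative y t) (at t)" if "t \<in> {0<..<T}" for t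
    using x(7)[OF that] by (simp add: y_def)
  have dy: "(y has_real_derivative (- u t * x t + 1 / (x t)\<^sup>2)) (at t)" if t: "t \<in> {0<..<T} - K" for t
  proof -
    have xt: "x t \<in> {1<..<\<gamma>}" "x t \<noteq> \<beta>" using x(6) t by (auto simp: K_def)
    then have "(top_speed \<gamma> has_real_derivative (- u t * x t + 1 / (x t)\<^sup>2) / top_speed \<gamma> (x t)) (at (x t))"
      using top_speed_derivative_accelerating[of "x t"] top_speed_derivative_braking[of "x t"]
      by (cases "x t < \<beta>") (auto simp: u_def)
    from DERIV_chain2[OF this x(7)] t top_speed_pos[OF xt(1)] show ?thesis
      by (simp add: y_def[abs_def])
  qed
  have "bounded (y ` {0..T})" by (intro compact_imp_bounded compact_continuous_image y_cont) simp
  then obtain B where B: "\<And>t. t \<in> {0..T} \<Longrightarrow> \<bar>y t\<bar> \<le> B"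
    unfolding bounded_iff real_norm_def by blast
  have "abs_continuous_on_interval 0 T x"
    by (rule AC_of_bounded_derivative[where K = "{}" and f' = y and B = B, OF _ x(1)]) (use dx B in auto)
  moreover have "abs_continuous_on_interval 0 T y"
  proof (rule AC_of_bounded_derivative[OF K y_cont dy])
    fix t assume "t \<in> {0<..<T} - K"
    then have xt: "x t \<in> {1<..<\<gamma>}" using x(6) by auto
    define c where "c = 1 / (x t)\<^sup>2"
    have "0 \<le> c" "c \<le> 1" using xt by (auto simp: c_def)
    then have "\<bar>- u t * x t + c\<bar> \<le> \<gamma> + 1" using xt by (auto simp: u_def)
    then show "\<bar>- u t * x t + 1 / (x t)\<^sup>2\<bar> \<le> \<gamma> + 1" by (simp only: c_def)
  qed
  moreover have "AE t in lebesgue_on {0..T}.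
        (x has_real_derivative y t) (at t within {0..T}) \<and>
        (y has_real_derivative (- u t * x t + 1 / (x t)\<^sup>2)) (at t within {0..T})"
  proof (rule AE_lebesgue_on_intervalI)
    show "negligible ({0, T} \<union> K)" using K by auto
    fix t assume "t \<in> {0..T} - ({0, T} \<union> K)"
    then have "t \<in> {0<..<T} - K" by auto
    then show "(x has_real_derivative y t) (at t within {0..T}) \<and>
        (y has_real_derivative (- u t * x t + 1 / (x t)\<^sup>2)) (at t within {0..T})"
      using dx[of t] dy[of t] by (auto intro: has_field_derivative_at_within)
  qed
  ultimately have "trajectory T u x y"
    using x(5) y_nonneg unfolding trajectory_def state_domain_def by fastforce
  moreover have "admissible_control T u"
  proof -
    have "x \<in> borel_measurable (lebesgue_on {0..T})"
      by (intro continuous_imp_measurable_on_sets_lebesgue x(1)) simp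
    then have "u \<in> borel_measurable (lebesgue_on {0..T})" unfolding u_def by measurable
    then show ?thesis by (auto simp: admissible_control_def u_def)
  qed
  moreover have "(x 0, y 0) = (1, 0)" "(x T, y T) = (\<gamma>, 0)"
    using x(3,4) top_speed_ends by (simp_all add: y_def)
  ultimately show ?thesis
    using less_imp_le[OF T] unfolding transfer_times_def T_def[symmetric] by blast
qed

end

theorem mainTheorem2:
  fixes \<gamma> \<beta> T\<^sub>1 T\<^sub>2 :: real and f\<^sub>1 f\<^sub>2 :: "real \<Rightarrow> real"
  assumes "\<gamma> > 1"
    and "\<beta> = sqrt ((\<gamma> ^ 3 - \<gamma> + 2) / (2 * \<gamma>))"
    and "f\<^sub>1 = (\<lambda>x. sqrt (x / ((x - 1) * (x\<^sup>2 + x + 2))))"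
    and "f\<^sub>2 = (\<lambda>x. sqrt (x / ((\<gamma> - x) * (x\<^sup>2 + \<gamma> * x - 2 / \<gamma>))))"
    and "T\<^sub>1 = integral {1..\<beta>} f\<^sub>1"
    and "T\<^sub>2 = integral {\<beta>..\<gamma>} f\<^sub>2"
  shows "f\<^sub>1 integrable_on {1..\<beta>} \<and> f\<^sub>2 integrable_on {\<beta>..\<gamma>} \<and> 1 \<le> \<beta> \<and> \<beta> \<le> \<gamma> \<and>
         is_minimum_time (1, 0) (\<gamma>, 0) (T\<^sub>1 + T\<^sub>2)"
proof -
  interpret transfer \<gamma> \<beta> by unfold_locales (use assms(1,2) in auto)
  have T: "integral {1..\<gamma>} (\<lambda>x. 1 / top_speed \<gamma> x) = T\<^sub>1 + T\<^sub>2"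
    using integral_unique[OF inverse_top_speed_has_integral] by (simp add: assms(3-6))
  have "is_minimum_time (1, 0) (\<gamma>, 0) (T\<^sub>1 + T\<^sub>2)"
    unfolding is_minimum_time_def T[symmetric]
    using transfer_time_attained transfer_time_lower_bound by blast
  then show ?thesis
    using integrable_accelerating integrable_braking beta_bounds by (simp add: assms(3,4))
qed

end
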